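(* Let $M:\{1,\dots,m\}\to\mathbb{Z}_{\ge 0}$ have exactly $n$ non-zero entries, let $0<\alpha<1$, and let $\theta\ge 1$. Let $S_{\mathrm{lab}}$ be the random summary produced by the laborious approach under high-pass filtering with parameter $\theta$, and let $S_{\mathrm{short}}$ be the random summary produced by Algorithm FILTER with parameter $\theta$ (both defined in the context). Then $S_{\mathrm{short}}$ and $S_{\mathrm{lab}}$ have the same probability distribution.
   Context: A summary is a finite set of pairs $(i,v)$ with $i\in\{1,\dots,m\}$ and $v$ a value, with at most one pair for each $i$; a location not appearing in the summary is interpreted as having value $0$. Geometric noise with parameter $\alpha$: an integer random variable $X$ with $\Pr[X=x]=\frac{1-\alpha}{1+\alpha}\alpha^{|x|}$ for all $x\in\mathbb{Z}$. (In the application, $\alpha=e^{-\epsilon/\Delta}$, where $\epsilon$ is the differential privacy parameter and $\Delta$ the sensitivity.) Laborious approach under high-pass filtering: for every $i\in\{1,\dots,m\}$ independently, set $M'(i)=M(i)+X_i$ with $X_i$ geometric noise with parameter $\alpha$. The summary is $\{(i,M'(i)) : M'(i)\ge\theta\}$. Algorithm FILTER: 1. For every $i$ with $M(i)\neq 0$, independently add geometric noise with parameter $\alpha$ to $M(i)$ to get $M'(i)$; if $M'(i)\ge\theta$, add $(i,M'(i))$ to the summary. 2. For the zero entries, sample (independently) $k$ from the binomial distribution $\mathrm{Bin}(m-n,p_\theta)$, where $p_\theta=\frac{\alpha^\theta}{1+\alpha}$. 3. Select uniformly at random $k$ distinct locations $i$ with $M(i)=0$. For each of these, independently draw $v$ according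 to the distribution $\Pr[X\le x]=1-\alpha^{x-\theta+1}$ for $x\ge\theta$, and add $(i,v)$ to the summary. *)

theory Defs
  imports "HOL-Probability.Probability"
begin

definition geometric_noise :: "real \<Rightarrow> int pmf" where
  "geometric_noise \<alpha> = embed_pmf (\<lambda>x. (1 - \<alpha>) / (1 + \<alpha>) * \<alpha> ^ nat \<bar>x\<bar>)"

text \<open>\<^const>\<open>embed_pmf\<close> is only meaningful for a genuine mass function; the following lemma
  shows that this is the case for every parameter strictly between 0 and 1.\<close>

lemma pmf_geometric_noise:
  assumes "0 < \<alpha>" "\<alpha> < 1"
  shows "pmf (geometric_noise \<alpha>) x = (1 - \<alpha>) / (1 + \<alpha>) * \<alpha> ^ nat \<bar>x\<bar>"
proof -
  define h where "h = bernoulli_pmf (1 / (1 + \<alpha>)) \<bind> (\<lambda>b.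
    map_pmf (\<lambda>n. if b then int n else - 1 - int n) (geometric_pmf (1 - \<alpha>)))"
  have inj: "inj (\<lambda>n. if b then int n else - 1 - int n)" for b
    by (auto simp: inj_def split: if_splits)
  have p: "0 \<le> 1 / (1 + \<alpha>)" "1 / (1 + \<alpha>) \<le> 1"
    using assms by (auto simp: field_simps)
  have bind: "pmf h y =
      1 / (1 + \<alpha>) * pmf (map_pmf int (geometric_pmf (1 - \<alpha>))) y +
      (1 - 1 / (1 + \<alpha>)) * pmf (map_pmf (\<lambda>n. - 1 - int n) (geometric_pmf (1 - \<alpha>))) y" for y
    unfolding h_def by (subst pmf_bind, subst integral_bernoulli_pmf) (use p in auto)
  have pmf_h: "pmf h y = (1 - \<alpha>) / (1 + \<alpha>) * \<alpha> ^ nat \<bar>y\<bar>" for y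
  proof (cases "y \<ge> 0")
    case True
    then obtain n where n: "y = int n" using zero_le_imp_eq_int by blast
    have 1: "pmf (map_pmf int (geometric_pmf (1 - \<alpha>))) y = \<alpha> ^ n * (1 - \<alpha>)"
      unfolding n by (subst pmf_map_inj') (use assms in \<open>auto simp: inj_def\<close>)
    have 2: "pmf (map_pmf (\<lambda>n. - 1 - int n) (geometric_pmf (1 - \<alpha>))) y = 0"
      unfolding n by (rule pmf_map_outside) auto
    have "nat \<bar>y\<bar> = n" using n by simp
    then show ?thesis unfolding bind 1 2 by simp
  next
    case False
    define n where "n = nat (- 1 - y)"
    have n: "y = - 1 - int n" using False by (simp add: n_def)
    have 1: "pmf (map_pmf int (geometric_pmf (1 - \<alpha>))) y = 0"
      unfolding n by (rule pmf_map_outside) auto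
    have 2: "pmf (map_pmf (\<lambda>n. - 1 - int n) (geometric_pmf (1 - \<alpha>))) y = \<alpha> ^ n * (1 - \<alpha>)"
      unfolding n by (subst pmf_map_inj'[of "\<lambda>n. - 1 - int n"]) (use assms in \<open>auto simp: inj_def\<close>)
    have "nat \<bar>y\<bar> = Suc n" using n by simp
    then show ?thesis unfolding bind 1 2 using assms by (simp add: field_simps)
  qed
  have "embed_pmf (pmf h) = h"
    using type_definition.Rep_inverse[OF td_pmf_embed_pmf] .
  moreover have "geometric_noise \<alpha> = embed_pmf (pmf h)"
    unfolding geometric_noise_def using pmf_h by presburger
  ultimately show ?thesis using pmf_h by simp
qed

text \<open>The distribution of the values given to selected zero entries. Its cumulative distribution
  function on the integers at least \<open>\<theta>\<close> is prescribed; there is no mass below \<open>\<theta>\<close>.\<close>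

definition filtered_value :: "real \<Rightarrow> int \<Rightarrow> int pmf" where
  "filtered_value \<alpha> \<theta> = (THE p. \<forall>x. measure_pmf.prob p {..x} =
     (if x \<ge> \<theta> then 1 - \<alpha> powi (x - \<theta> + 1) else 0))"

lemma ex1_filtered_value:
  assumes "0 < \<alpha>" "\<alpha> < 1"
  shows "\<exists>!p. \<forall>x. measure_pmf.prob p {..x} =
     (if x \<ge> \<theta> then 1 - \<alpha> powi (x - \<theta> + 1) else 0)"
proof (rule ex_ex1I)
  let ?p = "map_pmf (\<lambda>n. \<theta> + int n) (geometric_pmf (1 - \<alpha>))"
  have "measure_pmf.prob ?p {..x} = (if x \<ge> \<theta> then 1 - \<alpha> powi (x - \<theta> + 1) else 0)" for x
  proof (cases "x \<ge> \<theta>")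
    case True
    define N where "N = nat (x - \<theta>)"
    have x: "x = \<theta> + int N" using True by (simp add: N_def)
    have "(\<lambda>n. \<theta> + int n) -` {..x} = {..N}" by (auto simp: x)
    then have "measure_pmf.prob ?p {..x} = (\<Sum>n\<le>N. \<alpha> ^ n * (1 - \<alpha>))"
      using assms by (simp add: measure_measure_pmf_finite)
    also have "\<dots> = 1 - \<alpha> ^ Suc N"
      by (induction N) (auto simp: algebra_simps)
    also have "\<dots> = 1 - \<alpha> powi (x - \<theta> + 1)"
      by (simp add: x power_int_def nat_add_distrib)
    finally show ?thesis using True by simp
  next
    case False
    then have "(\<lambda>n. \<theta> + int n) -` {..x} = {}" by auto
    with False show ?thesis by simp
  qed
  then show "\<exists>p. \<forall>x. measure_pmf.prob p {..x} =
     (if x \<ge> \<theta> then 1 - \<alpha> powi (x - \<theta> + 1) else 0)" by blast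
next
  fix p q :: "int pmf"
  assume p: "\<forall>x. measure_pmf.prob p {..x} = (if x \<ge> \<theta> then 1 - \<alpha> powi (x - \<theta> + 1) else 0)"
    and q: "\<forall>x. measure_pmf.prob q {..x} = (if x \<ge> \<theta> then 1 - \<alpha> powi (x - \<theta> + 1) else 0)"
  have "pmf r x = measure_pmf.prob r {..x} - measure_pmf.prob r {..x - 1}" for r :: "int pmf" and x
  proof -
    have "{..x} - {..x - 1} = {x}" by auto
    moreover have "measure_pmf.prob r ({..x} - {..x - 1}) =
        measure_pmf.prob r {..x} - measure_pmf.prob r {..x - 1}"
      by (rule measure_pmf.finite_measure_Diff) auto
    ultimately show ?thesis by (simp add: measure_pmf_single)
  qed
  then show "p = q" using p q by (intro pmf_eqI) simp
qed

lemma prob_filtered_value_atMost: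
  assumes "0 < \<alpha>" "\<alpha> < 1"
  shows "measure_pmf.prob (filtered_value \<alpha> \<theta>) {..x} =
     (if x \<ge> \<theta> then 1 - \<alpha> powi (x - \<theta> + 1) else 0)"
  using theI'[OF ex1_filtered_value[OF assms, of \<theta>]] unfolding filtered_value_def by blast

type_synonym summary = "(nat \<times> int) set"

text \<open>The default value of \<^const>\<open>Pi_pmf\<close> is irrelevant below: the random functions are only
  read on their index sets.\<close>

definition laborious_summary :: "nat \<Rightarrow> (nat \<Rightarrow> nat) \<Rightarrow> real \<Rightarrow> int \<Rightarrow> summary pmf" where
  "laborious_summary m M \<alpha> \<theta> = do {
     M' \<leftarrow> Pi_pmf {1..m} 0 (\<lambda>i. map_pmf (\<lambda>x. int (M i) + x) (geometric_noise \<alpha>));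
     return_pmf {(i, M' i) |i. i \<in> {1..m} \<and> M' i \<ge> \<theta>}
   }"

definition filter_summary :: "nat \<Rightarrow> nat \<Rightarrow> (nat \<Rightarrow> nat) \<Rightarrow> real \<Rightarrow> int \<Rightarrow> summary pmf" where
  "filter_summary m n M \<alpha> \<theta> = do {
     M' \<leftarrow> Pi_pmf {i \<in> {1..m}. M i \<noteq> 0} 0
       (\<lambda>i. map_pmf (\<lambda>x. int (M i) + x) (geometric_noise \<alpha>));
     k \<leftarrow> binomial_pmf (m - n) (\<alpha> powi \<theta> / (1 + \<alpha>));
     L \<leftarrow> pmf_of_set {L. L \<subseteq> {i \<in> {1..m}. M i = 0} \<and> card L = k};
     v \<leftarrow> Pi_pmf L 0 (\<lambda>_. filtered_value \<alpha> \<theta>);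
     return_pmf ({(i, M' i) |i. i \<in> {1..m} \<and> M i \<noteq> 0 \<and> M' i \<ge> \<theta>} \<union> {(i, v i) |i. i \<in> L})
   }"

end

theory Submission
  imports Defs
begin

text \<open>Replacing every noisy value below \<open>\<theta>\<close> by \<open>0\<close> does not change the summary, because \<open>\<theta> \<ge> 1\<close>.
  At a zero entry the truncated noise is a coin flip with success probability
  \<open>\<alpha> powi \<theta> / (1 + \<alpha>)\<close> followed, on success, by an independent \<^const>\<open>filtered_value\<close>. The set of
  successes of independent coin flips is a uniformly random set of binomially distributed size, so
  drawing all the coins first and then the values at the successes yields Algorithm FILTER.\<close>

text \<open>Total mass is 1, so the mass at \<open>a\<close> is forced by the masses elsewhere. This
  avoids summing the noise below \<open>\<theta>\<close> that truncation collects at 0.\<close>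

lemma pmf_eqI_except:
  assumes "\<And>x. x \<noteq> a \<Longrightarrow> pmf p x = pmf q x"
  shows "p = q"
proof (rule pmf_eqI)
  have compl: "pmf r a = 1 - measure_pmf.prob r (- {a})" for r :: "'a pmf"
    using measure_pmf.prob_compl[of "{a}" r] by (simp add: Compl_eq_Diff_UNIV measure_pmf_single)
  have "measure_pmf.prob p (- {a}) = measure_pmf.prob q (- {a})"
    unfolding measure_pmf_conv_infsetsum
    by (rule infsetsum_cong) (use assms in auto)
  then show "pmf p x = pmf q x" for x
    using assms compl by (cases "x = a") auto
qed

lemma inj_Collect: "inj Collect"
  by (simp add: inj_def set_eq_iff fun_eq_iff)

text \<open>On both sides a subset \<open>L\<close> of \<open>A\<close> gets mass
  \<open>p ^ card L * (1 - p) ^ (card A - card L)\<close>: the binomial coefficient cancels against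
  the uniform choice among the sets of the same size.\<close>

lemma binomial_pmf_bind_pmf_of_set_subsets:
  assumes "finite A" "p \<in> {0..1}"
  shows "binomial_pmf (card A) p \<bind> (\<lambda>k. pmf_of_set {L. L \<subseteq> A \<and> card L = k}) =
    map_pmf (\<lambda>f. {i \<in> A. f i}) (Pi_pmf A False (\<lambda>_. bernoulli_pmf p))"
proof (rule pmf_eqI)
  fix L
  let ?n = "card A" and ?w = "\<lambda>k. p ^ k * (1 - p) ^ (card A - k)"
  \<comment> \<open>The bound on \<open>k\<close> makes the family of candidate sets nonempty,
    without which \<open>pmf_of_set\<close> is not meaningful.\<close>
  have subsets: "pmf (pmf_of_set {L. L \<subseteq> A \<and> card L = k}) L =
      (if L \<subseteq> A \<and> card L = k then 1 / (?n choose k) else 0)" if "k \<le> ?n" for k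
  proof -
    have "card {L. L \<subseteq> A \<and> card L = k} = ?n choose k"
      using assms(1) by (rule n_subsets)
    moreover from this have "{L. L \<subseteq> A \<and> card L = k} \<noteq> {}"
      using that by (metis binomial_eq_0_iff card.empty not_le)
    ultimately show ?thesis
      using assms(1) by (subst pmf_of_set) (auto simp: indicator_def)
  qed
  have "pmf (binomial_pmf ?n p \<bind> (\<lambda>k. pmf_of_set {L. L \<subseteq> A \<and> card L = k})) L =
      (\<Sum>k\<le>?n. real (?n choose k) * p ^ k * (1 - p) ^ (?n - k) *
        pmf (pmf_of_set {L. L \<subseteq> A \<and> card L = k}) L)"
    using assms(2) by (simp add: pmf_bind expectation_binomial_pmf')
  also have "\<dots> = (\<Sum>k\<le>?n. if k = card L then (if L \<subseteq> A then ?w k else 0) else 0)"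
    by (rule sum.cong) (auto simp: subsets)
  \<comment> \<open>The predicate with extension \<open>L\<close> is the one outcome of the coins
    that yields \<open>L\<close>. If \<open>L\<close> leaves \<open>A\<close>, it violates the
    default \<open>False\<close> and has mass 0.\<close>
  also have "\<dots> = (if L \<subseteq> A then ?w (card L) else 0)"
    using assms(1) by (auto simp: card_mono)
  also have "\<dots> = pmf (Pi_pmf A False (\<lambda>_. bernoulli_pmf p)) (\<lambda>i. i \<in> L)"
  proof (cases "L \<subseteq> A")
    case True
    have "(\<Prod>x\<in>A. pmf (bernoulli_pmf p) (x \<in> L)) =
        (\<Prod>x\<in>A. if x \<in> L then p else 1 - p)"
      using assms(2) by (intro prod.cong) auto
    also have "\<dots> = p ^ card (A \<inter> L) * (1 - p) ^ card (A - L)"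
      using assms(1) by (simp add: prod.If_cases Diff_eq)
    also have "\<dots> = ?w (card L)"
      using True assms(1) by (simp add: Int_absorb1 card_Diff_subset finite_subset)
    finally show ?thesis
      using True assms(1) by (auto simp: pmf_Pi)
  qed (use assms(1) in \<open>auto simp: pmf_Pi\<close>)
  also have "\<dots> = pmf (map_pmf Collect (Pi_pmf A False (\<lambda>_. bernoulli_pmf p))) L"
    using pmf_map_inj'[OF inj_Collect, of _ "\<lambda>i. i \<in> L"] by simp
  \<comment> \<open>Outcomes in the support are \<open>False\<close> outside \<open>A\<close>, so
    intersecting with \<open>A\<close> changes nothing.\<close>
  also have "map_pmf Collect (Pi_pmf A False (\<lambda>_. bernoulli_pmf p)) =
      map_pmf (\<lambda>f. {i \<in> A. f i}) (Pi_pmf A False (\<lambda>_. bernoulli_pmf p))"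
    using set_Pi_pmf_subset[OF assms(1), of False] by (intro map_pmf_cong) blast+
  finally show "pmf (binomial_pmf ?n p \<bind> (\<lambda>k. pmf_of_set {L. L \<subseteq> A \<and> card L = k})) L =
      pmf (map_pmf (\<lambda>f. {i \<in> A. f i}) (Pi_pmf A False (\<lambda>_. bernoulli_pmf p))) L" .
qed

text \<open>Consecutive values of the distribution function are subtracted; what results is a
  geometric law with ratio \<open>\<alpha>\<close>, shifted to start at
  \<open>\<theta>\<close>.\<close>

lemma pmf_filtered_value:
  assumes "0 < \<alpha>" "\<alpha> < 1"
  shows "pmf (filtered_value \<alpha> \<theta>) x = (if x \<ge> \<theta> then (1 - \<alpha>) * \<alpha> powi (x - \<theta>) else 0)"
proof -
  let ?P = "measure_pmf.prob (filtered_value \<alpha> \<theta>)"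
  have "{..x} - {..x - 1} = {x}" by auto
  moreover have "?P ({..x} - {..x - 1}) = ?P {..x} - ?P {..x - 1}"
    by (rule measure_pmf.finite_measure_Diff) auto
  ultimately have "pmf (filtered_value \<alpha> \<theta>) x = ?P {..x} - ?P {..x - 1}"
    by (simp add: measure_pmf_single)
  moreover have "\<alpha> powi (x - \<theta> + 1) = \<alpha> powi (x - \<theta>) * \<alpha>"
    using assms by (simp add: power_int_add_1)
  \<comment> \<open>At \<open>x = \<theta>\<close> the prescribed function is in its zero branch,
    but \<open>1 - \<alpha> powi 0\<close> is 0 as well, so one formula covers all
    \<open>x \<ge> \<theta>\<close>.\<close>
  moreover have "?P {..x - 1} = (if x \<ge> \<theta> then 1 - \<alpha> powi (x - \<theta>) else 0)"
    using prob_filtered_value_atMost[OF assms, of \<theta> "x - 1"] by (cases "x = \<theta>") auto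
  ultimately show ?thesis
    by (simp add: prob_filtered_value_atMost[OF assms] left_diff_distrib mult.commute)
qed

lemma set_pmf_filtered_value:
  assumes "0 < \<alpha>" "\<alpha> < 1"
  shows "set_pmf (filtered_value \<alpha> \<theta>) \<subseteq> {\<theta>..}"
  by (auto simp: set_pmf_iff pmf_filtered_value[OF assms] split: if_splits)

lemma filter_probability_bounds:
  fixes \<alpha> :: real
  assumes "0 < \<alpha>" "\<alpha> < 1" "0 \<le> \<theta>"
  shows "\<alpha> powi \<theta> / (1 + \<alpha>) \<in> {0..1}"
proof -
  have "\<alpha> powi \<theta> \<le> 1"
    using assms by (simp add: power_int_def power_le_one)
  then have "\<alpha> powi \<theta> / (1 + \<alpha>) \<le> 1"
    using assms by (simp add: divide_le_eq)
  then show ?thesis using assms by simp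
qed

text \<open>The coin's parameter is the tail probability of the noise at \<open>\<theta>\<close>,
  and by memorylessness the noise conditioned on that tail is \<open>filtered_value\<close>. It
  suffices to compare masses away from 0.\<close>

lemma truncated_geometric_noise:
  assumes "0 < \<alpha>" "\<alpha> < 1" "1 \<le> \<theta>"
  shows "map_pmf (\<lambda>x. if \<theta> \<le> x then x else 0) (geometric_noise \<alpha>) =
    bernoulli_pmf (\<alpha> powi \<theta> / (1 + \<alpha>)) \<bind>
      (\<lambda>b. if b then filtered_value \<alpha> \<theta> else return_pmf 0)"
proof (rule pmf_eqI_except[where a = 0])
  fix x :: int
  assume x: "x \<noteq> 0"
  let ?t = "\<lambda>x::int. if \<theta> \<le> x then x else 0"
  have "?t -` {x} = (if \<theta> \<le> x then {x} else {})"
    using x by (auto split: if_splits)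
  then have lhs: "pmf (map_pmf ?t (geometric_noise \<alpha>)) x =
      (if \<theta> \<le> x then (1 - \<alpha>) / (1 + \<alpha>) * \<alpha> ^ nat \<bar>x\<bar> else 0)"
    by (simp add: pmf_map measure_pmf_single pmf_geometric_noise[OF assms(1,2)])
  have "pmf (bernoulli_pmf (\<alpha> powi \<theta> / (1 + \<alpha>)) \<bind>
      (\<lambda>b. if b then filtered_value \<alpha> \<theta> else return_pmf 0)) x =
      \<alpha> powi \<theta> / (1 + \<alpha>) * pmf (filtered_value \<alpha> \<theta>) x"
    unfolding pmf_bind
    by (subst integral_bernoulli_pmf)
      (use x filter_probability_bounds[of \<alpha> \<theta>] assms in auto)
  moreover have "\<alpha> ^ nat \<bar>x\<bar> = \<alpha> powi \<theta> * \<alpha> powi (x - \<theta>)" if "\<theta> \<le> x"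
  proof -
    have "\<alpha> powi \<theta> * \<alpha> powi (x - \<theta>) = \<alpha> powi x"
      using assms(1) by (simp flip: power_int_add)
    then show ?thesis using that assms(3) by (simp add: power_int_def)
  qed
  ultimately show "pmf (map_pmf ?t (geometric_noise \<alpha>)) x =
      pmf (bernoulli_pmf (\<alpha> powi \<theta> / (1 + \<alpha>)) \<bind>
        (\<lambda>b. if b then filtered_value \<alpha> \<theta> else return_pmf 0)) x"
    unfolding lhs by (simp add: pmf_filtered_value[OF assms(1,2)])
qed

lemma noise_summary_eq_sampled_summary:
  fixes Z :: "'a set"
  assumes "0 < \<alpha>" "\<alpha> < 1" "1 \<le> \<theta>" "finite Z"
  shows "map_pmf (\<lambda>f. {(i, f i) |i. i \<in> Z \<and> \<theta> \<le> f i}) (Pi_pmf Z 0 (\<lambda>_. geometric_noise \<alpha>)) =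
    do {
      k \<leftarrow> binomial_pmf (card Z) (\<alpha> powi \<theta> / (1 + \<alpha>));
      L \<leftarrow> pmf_of_set {L. L \<subseteq> Z \<and> card L = k};
      v \<leftarrow> Pi_pmf L 0 (\<lambda>_. filtered_value \<alpha> \<theta>);
      return_pmf {(i, v i) |i. i \<in> L}
    }"
proof -
  let ?t = "\<lambda>x::int. if \<theta> \<le> x then x else 0"
  let ?S = "\<lambda>f::'a \<Rightarrow> int. {(i, f i) |i. i \<in> Z \<and> \<theta> \<le> f i}"
  let ?p = "\<alpha> powi \<theta> / (1 + \<alpha>)"
  let ?V = "\<lambda>L. Pi_pmf L 0 (\<lambda>_. filtered_value \<alpha> \<theta>)"
  \<comment> \<open>The threshold recovers exactly \<open>L\<close>: sampled values are at least
    \<open>\<theta>\<close>, while the default 0 outside \<open>L\<close> lies below it.\<close>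
  have sampled: "map_pmf ?S (?V L) = map_pmf (\<lambda>v. {(i, v i) |i. i \<in> L}) (?V L)" if "L \<subseteq> Z" for L
  proof (rule map_pmf_cong[OF refl])
    fix v assume "v \<in> set_pmf (?V L)"
    then have "v \<in> PiE_dflt L 0 (\<lambda>_. set_pmf (filtered_value \<alpha> \<theta>))"
      using finite_subset[OF that assms(4)] by (simp add: set_Pi_pmf o_def)
    then have "(i \<in> L \<longrightarrow> \<theta> \<le> v i) \<and> (i \<notin> L \<longrightarrow> v i = 0)" for i
      using set_pmf_filtered_value[OF assms(1,2), of \<theta>] by (auto simp: PiE_dflt_def)
    then have "i \<in> Z \<and> \<theta> \<le> v i \<longleftrightarrow> i \<in> L" for i
      using that assms(3) by (cases "i \<in> L") auto
    then show "?S v = {(i, v i) |i. i \<in> L}" by simp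
  qed
  have "?S (?t \<circ> f) = ?S f" for f
    using assms(3) by auto
  then have "map_pmf ?S (Pi_pmf Z 0 (\<lambda>_. geometric_noise \<alpha>)) =
      map_pmf ?S (map_pmf (\<lambda>f. ?t \<circ> f) (Pi_pmf Z 0 (\<lambda>_. geometric_noise \<alpha>)))"
    by (simp only: pmf.map_comp o_def)
  \<comment> \<open>Truncation acts coordinatewise and fixes the default 0.\<close>
  also have "map_pmf (\<lambda>f. ?t \<circ> f) (Pi_pmf Z 0 (\<lambda>_. geometric_noise \<alpha>)) =
      Pi_pmf Z 0 (\<lambda>_. map_pmf ?t (geometric_noise \<alpha>))"
    by (rule Pi_pmf_map[symmetric]) (use assms in auto)
  \<comment> \<open>Independence lets all coins be flipped before any value is drawn. A failed coin
    returns 0, the default, so the product shrinks to the set of successes.\<close>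
  also have "\<dots> = Pi_pmf Z False (\<lambda>_. bernoulli_pmf ?p) \<bind> (\<lambda>b. ?V {i \<in> Z. b i})"
    unfolding truncated_geometric_noise[OF assms(1-3)]
    by (simp only: Pi_pmf_bind[OF assms(4), where d' = False] Pi_pmf_if_set[OF assms(4)])
  also have "map_pmf ?S \<dots> =
      map_pmf (\<lambda>b. {i \<in> Z. b i}) (Pi_pmf Z False (\<lambda>_. bernoulli_pmf ?p)) \<bind>
        (\<lambda>L. map_pmf (\<lambda>v. {(i, v i) |i. i \<in> L}) (?V L))"
    unfolding map_bind_pmf bind_map_pmf by (intro bind_pmf_cong refl sampled) auto
  also have "map_pmf (\<lambda>b. {i \<in> Z. b i}) (Pi_pmf Z False (\<lambda>_. bernoulli_pmf ?p)) =
      binomial_pmf (card Z) ?p \<bind> (\<lambda>k. pmf_of_set {L. L \<subseteq> Z \<and> card L = k})"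
    using assms filter_probability_bounds
    by (intro binomial_pmf_bind_pmf_of_set_subsets[symmetric]) auto
  finally show ?thesis
    by (simp only: bind_assoc_pmf map_pmf_def)
qed

theorem theorem1:
  fixes m n :: nat and M :: "nat \<Rightarrow> nat" and \<alpha> :: real and \<theta> :: int
  assumes "card {i \<in> {1..m}. M i \<noteq> 0} = n"
    and "0 < \<alpha>" and "\<alpha> < 1"
    and "\<theta> \<ge> 1"
  shows "filter_summary m n M \<alpha> \<theta> = laborious_summary m M \<alpha> \<theta>"
proof -
  let ?N = "{i \<in> {1..m}. M i \<noteq> 0}" and ?Z = "{i \<in> {1..m}. M i = 0}"
  let ?noise = "\<lambda>i. map_pmf (\<lambda>x. int (M i) + x) (geometric_noise \<alpha>)"
  let ?T = "\<lambda>f::nat \<Rightarrow> int. {(i, f i) |i. i \<in> {1..m} \<and> M i \<noteq> 0 \<and> \<theta> \<le> f i}"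
  let ?S = "\<lambda>f::nat \<Rightarrow> int. {(i, f i) |i. i \<in> ?Z \<and> \<theta> \<le> f i}"
  have split: "{1..m} = ?N \<union> ?Z" by auto
  have "card {1..m} = card ?N + card ?Z"
    by (subst split, rule card_Un_disjoint) auto
  then have card_Z: "card ?Z = m - n"
    using assms(1) by simp
  have zero_noise: "Pi_pmf ?Z 0 ?noise = Pi_pmf ?Z 0 (\<lambda>_. geometric_noise \<alpha>)"
    by (rule Pi_pmf_cong) auto
  \<comment> \<open>The equation for \<open>h\<close> is a premise so that \<open>refl\<close> turns
    this into a rewrite rule for the merged function.\<close>
  have summary: "{(i, h i) |i. i \<in> {1..m} \<and> \<theta> \<le> h i} = ?T f \<union> ?S g"
    if "h = (\<lambda>i. if i \<in> ?N then f i else g i)" for f g h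
    unfolding that by auto
  \<comment> \<open>Noise on the non-zero and the zero entries is independent; only the latter is
    resampled below, the former being common to both procedures.\<close>
  have "Pi_pmf {1..m} 0 ?noise = map_pmf (\<lambda>(f, g) i. if i \<in> ?N then f i else g i)
      (pair_pmf (Pi_pmf ?N 0 ?noise) (Pi_pmf ?Z 0 ?noise))"
    by (subst split, rule Pi_pmf_union) auto
  then have "laborious_summary m M \<alpha> \<theta> =
      Pi_pmf ?N 0 ?noise \<bind> (\<lambda>f. Pi_pmf ?Z 0 ?noise \<bind> (\<lambda>g. return_pmf (?T f \<union> ?S g)))"
    unfolding laborious_summary_def
    by (simp only: pair_pmf_def map_bind_pmf bind_map_pmf bind_assoc_pmf bind_return_pmf
        map_return_pmf prod.case summary[OF refl])
  also have "\<dots> = Pi_pmf ?N 0 ?noise \<bind> (\<lambda>f.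
      map_pmf ?S (Pi_pmf ?Z 0 (\<lambda>_. geometric_noise \<alpha>)) \<bind> (\<lambda>s. return_pmf (?T f \<union> s)))"
    unfolding zero_noise by (simp only: bind_map_pmf)
  also have "map_pmf ?S (Pi_pmf ?Z 0 (\<lambda>_. geometric_noise \<alpha>)) =
    do {
      k \<leftarrow> binomial_pmf (card ?Z) (\<alpha> powi \<theta> / (1 + \<alpha>));
      L \<leftarrow> pmf_of_set {L. L \<subseteq> ?Z \<and> card L = k};
      v \<leftarrow> Pi_pmf L 0 (\<lambda>_. filtered_value \<alpha> \<theta>);
      return_pmf {(i, v i) |i. i \<in> L}
    }"
    by (rule noise_summary_eq_sampled_summary) (use assms in auto)
  finally show ?thesis
    unfolding filter_summary_def card_Z by (simp only: bind_assoc_pmf bind_return_pmf)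
qed

end
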